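(* For every integer $m\ge 2$ there exists a color complete $m$-pole.
   Context: An $m$-pole ($m\ge 1$), or multipole, $M=(V,E,\mathcal{E})$ consists of a finite set $V$ of vertices, a finite collection $E$ of edges (unordered pairs of vertices; parallel edges and loops may occur), and a set $\mathcal{E}=\{\epsilon_1,\dots,\epsilon_m\}$ of $m$ semiedges. Each semiedge is either incident to exactly one vertex, or is paired with another semiedge to form a free (isolated) edge, which has no vertices. All multipoles are cubic: for each vertex, the number of edges (loops counted twice) plus semiedges incident to it is $3$. A multipole may be disconnected, and $V$ may be empty. A Tait coloring of $M$ is a map $\phi:E\cup\mathcal{E}\to\{1,2,3\}$ such that the three edges/semiedges incident with any vertex receive distinct colors (so a multipole with a loop has none) and the two semiedges of any free edge receive the same color. A state of $M$ is a tuple $(\phi(\epsilon_1),\dots,\phi(\epsilon_m))$ with $\phi$ a Tait coloring of $M$. A tuple in $\{1,2,3\}^m$ is admissible if, with $m_i$ the number of entries equal to $i$, $m_1\equiv m_2\equiv m_3\equiv m\pmod 2$. (By the Parity Lemma every state is admissible.) $M$ is color complete if every admissible tuple is a state of $M$. *)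

theory Defs
  imports Main "HOL-Library.Multiset"
begin

datatype 'v semiend = At 'v | Paired nat

text \<open>
  Edges carry labels of type \<open>'e\<close>, so parallel edges are distinct labels with the same
  ends; \<open>ends M e\<close> is the unordered pair of end vertices of \<open>e\<close> as a multiset of size 2,
  a loop at \<open>v\<close> being \<open>{#v, v#}\<close>. The semiedges of an \<open>m\<close>-pole are identified with their
  indices \<open>1, \<dots>, m\<close>: \<open>attach M i = At v\<close> means that the \<open>i\<close>-th semiedge is incident to
  the vertex \<open>v\<close>, and \<open>attach M i = Paired j\<close> that it forms a free edge with the \<open>j\<close>-th one.
\<close>

record ('v, 'e) multipole =
  verts :: "'v set"
  edges :: "'e set"
  ends :: "'e \<Rightarrow> 'v multiset"
  nsemi :: nat
  attach :: "nat \<Rightarrow> 'v semiend"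

definition semiedges :: "('v, 'e) multipole \<Rightarrow> nat set" where
  "semiedges M = {1..nsemi M}"

text \<open>
  The edges (tagged \<open>Inl\<close>) and semiedges (tagged \<open>Inr\<close>) incident with a vertex, as a
  multiset in which a loop occurs twice.
\<close>

definition incident :: "('v, 'e) multipole \<Rightarrow> 'v \<Rightarrow> ('e + nat) multiset" where
  "incident M v =
     (\<Sum>e\<in>edges M. replicate_mset (count (ends M e) v) (Inl e)) +
     image_mset Inr (mset_set {i \<in> semiedges M. attach M i = At v})"

definition m_pole :: "nat \<Rightarrow> ('v, 'e) multipole \<Rightarrow> bool" where
  "m_pole m M \<longleftrightarrow>
     m \<ge> 1 \<and> nsemi M = m \<and>
     finite (verts M) \<and> finite (edges M) \<and>
     (\<forall>e\<in>edges M. size (ends M e) = 2 \<and> set_mset (ends M e) \<subseteq> verts M) \<and>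
     (\<forall>i\<in>semiedges M. case attach M i of
        At v \<Rightarrow> v \<in> verts M
      | Paired j \<Rightarrow> j \<in> semiedges M \<and> j \<noteq> i \<and> attach M j = Paired i) \<and>
     (\<forall>v\<in>verts M. size (incident M v) = 3)"

definition tait_coloring :: "('v, 'e) multipole \<Rightarrow> ('e + nat \<Rightarrow> nat) \<Rightarrow> bool" where
  "tait_coloring M \<phi> \<longleftrightarrow>
     \<phi> ` (edges M <+> semiedges M) \<subseteq> {1, 2, 3} \<and>
     (\<forall>v\<in>verts M. \<forall>c. count (image_mset \<phi> (incident M v)) c \<le> 1) \<and>
     (\<forall>i\<in>semiedges M. \<forall>j. attach M i = Paired j \<longrightarrow> \<phi> (Inr i) = \<phi> (Inr j))"

definition is_state :: "('v, 'e) multipole \<Rightarrow> nat list \<Rightarrow> bool" where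
  "is_state M xs \<longleftrightarrow>
     (\<exists>\<phi>. tait_coloring M \<phi> \<and> xs = map (\<lambda>i. \<phi> (Inr i)) [1..<Suc (nsemi M)])"

definition admissible :: "nat \<Rightarrow> nat list \<Rightarrow> bool" where
  "admissible m xs \<longleftrightarrow>
     length xs = m \<and> set xs \<subseteq> {1, 2, 3} \<and>
     (\<forall>c\<in>{1, 2, 3}. count_list xs c mod 2 = m mod 2)"

definition color_complete :: "('v, 'e) multipole \<Rightarrow> bool" where
  "color_complete M \<longleftrightarrow> (\<forall>xs. admissible (nsemi M) xs \<longrightarrow> is_state M xs)"

end

theory Submission imports Defs begin

text \<open>
  Regard the colours as the nonzero elements of the Klein four-group, so that the admissible
  tuples are those of sum zero. There is a 5-pole on seven vertices whose states restrict to
  all 27 triples on three of its semiedges, the outputs; its two remaining semiedges then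
  carry colours with the same sum as the outputs. Joining these two to two semiedges of a colour
  complete \<open>m\<close>-pole gives a colour complete \<open>(m + 1)\<close>-pole: an admissible tuple determines the
  outputs, hence colours on the two joined edges, and the \<open>m\<close>-tuple thus left for the old pole is
  again admissible. The induction starts from a single vertex with \<open>m = 3\<close>; a free edge settles
  \<open>m = 2\<close>.
\<close>

section \<open>Multipoles given by vertex neighbourhoods\<close>

text \<open>
  A multipole without free edges is given by the list of its vertex neighbourhoods: \<open>Inl e\<close> for
  the edges \<open>e < k\<close> and \<open>Inr i\<close> for the semiedges \<open>i \<in> {1..m}\<close>.
\<close>

definition wiring :: "nat \<Rightarrow> nat \<Rightarrow> (nat + nat) multiset list \<Rightarrow> bool" where
  "wiring m k C \<longleftrightarrow> (\<forall>t\<in>set C. size t = 3) \<and>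
     sum_list C = image_mset Inl (mset_set {..<k}) + image_mset Inl (mset_set {..<k})
       + image_mset Inr (mset_set {1..m})"

definition wiring_coloring :: "(nat + nat) multiset list \<Rightarrow> (nat + nat \<Rightarrow> nat) \<Rightarrow> bool" where
  "wiring_coloring C \<phi> \<longleftrightarrow> range \<phi> \<subseteq> {1, 2, 3} \<and> (\<forall>t\<in>set C. \<forall>c. count (image_mset \<phi> t) c \<le> 1)"

definition wiring_complete :: "nat \<Rightarrow> (nat + nat) multiset list \<Rightarrow> bool" where
  "wiring_complete m C \<longleftrightarrow> (\<forall>xs. admissible m xs \<longrightarrow>
     (\<exists>\<phi>. wiring_coloring C \<phi> \<and> map (\<lambda>i. \<phi> (Inr i)) [1..<Suc m] = xs))"

text \<open>Vertices are the positions in \<open>C\<close>. Using \<open>count\<close> in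
  \<open>ends\<close> makes a label occurring twice in one neighbourhood a loop there. For
  \<open>i\<close> in \<open>{1..m}\<close> the \<open>THE\<close> has a unique witness once
  \<open>wiring m k C\<close> holds.\<close>

definition pole_of_wiring :: "nat \<Rightarrow> nat \<Rightarrow> (nat + nat) multiset list \<Rightarrow> (nat, nat) multipole" where
  "pole_of_wiring m k C =
     \<lparr>verts = {..<length C}, edges = {..<k},
      ends = (\<lambda>e. \<Sum>v<length C. replicate_mset (count (C ! v) (Inl e)) v),
      nsemi = m,
      attach = (\<lambda>i. At (THE v. v < length C \<and> Inr i \<in># C ! v))\<rparr>"

lemma count_sum_list_nth:
  "count (sum_list C) x = (\<Sum>v<length C. count (C ! v) x)"
  by (simp add: sum_list_sum_nth count_sum atLeast0LessThan)

lemma count_image_mset_inj: "inj f \<Longrightarrow> count (image_mset f A) (f x) = count A x"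
  by (induction A) (auto dest: injD)

text \<open>Obtained by counting one label on both sides of the equation in \<open>wiring\<close>:
  edges have two ends, semiedges one.\<close>

lemma count_wiring:
  assumes "wiring m k C"
  shows "(\<Sum>v<length C. count (C ! v) (Inl e)) = (if e < k then 2 else 0)"
    and "(\<Sum>v<length C. count (C ! v) (Inr i)) = (if i \<in> {1..m} then 1 else 0)"
proof -
  have inl: "count (image_mset Inl A) (Inr i) = 0" for A :: "nat multiset"
    by (auto simp: not_in_iff [symmetric])
  have inr: "count (image_mset Inr A) (Inl e) = 0" for A :: "nat multiset"
    by (auto simp: not_in_iff [symmetric])
  have *: "sum_list C = image_mset Inl (mset_set {..<k}) + image_mset Inl (mset_set {..<k})
      + image_mset Inr (mset_set {1..m})"
    using assms by (simp add: wiring_def)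
  show "(\<Sum>v<length C. count (C ! v) (Inl e)) = (if e < k then 2 else 0)"
    unfolding count_sum_list_nth [symmetric] *
    by (simp add: inr count_image_mset_inj count_mset_set')
  show "(\<Sum>v<length C. count (C ! v) (Inr i)) = (if i \<in> {1..m} then 1 else 0)"
    unfolding count_sum_list_nth [symmetric] *
    by (simp add: inl count_image_mset_inj count_mset_set')
qed

lemma count_ends_pole_of_wiring:
  "count (ends (pole_of_wiring m k C) e) v = (if v < length C then count (C ! v) (Inl e) else 0)"
  by (simp add: pole_of_wiring_def count_sum)

text \<open>A sum of naturals equal to 1 has exactly one nonzero summand, and that summand is 1; its
  position is the vertex picked by \<open>THE\<close>.\<close>

lemma wiring_semiedge:
  assumes "wiring m k C" "i \<in> {1..m}"
  obtains u where "u < length C" "count (C ! u) (Inr i) = 1"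
    "\<And>v. v < length C \<Longrightarrow> v \<noteq> u \<Longrightarrow> count (C ! v) (Inr i) = 0"
    "attach (pole_of_wiring m k C) i = At u"
proof -
  have "(\<Sum>v<length C. count (C ! v) (Inr i)) = 1"
    using count_wiring(2) [OF assms(1), of i] assms(2) by simp
  then obtain u where u: "u < length C" "count (C ! u) (Inr i) = 1"
    "\<And>v. v < length C \<Longrightarrow> v \<noteq> u \<Longrightarrow> count (C ! v) (Inr i) = 0"
    by (subst (asm) sum_eq_1_iff) auto
  have "(THE v. v < length C \<and> Inr i \<in># C ! v) = u"
  proof (rule the_equality)
    show "u < length C \<and> Inr i \<in># C ! u"
      using u by (simp add: count_inI)
    show "v = u" if "v < length C \<and> Inr i \<in># C ! v" for v
      using that u(3) [of v] by (auto simp: not_in_iff [symmetric])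
  qed
  then show thesis
    using that u by (simp add: pole_of_wiring_def)
qed

text \<open>Multiplicities are compared label by label. Labels outside \<open>{..<k}\<close> and
  \<open>{1..m}\<close> cause no discrepancy, since by \<open>count_wiring\<close> they do not occur
  in \<open>C\<close>.\<close>

lemma incident_pole_of_wiring:
  assumes C: "wiring m k C" and v: "v < length C"
  shows "incident (pole_of_wiring m k C) v = C ! v"
proof (rule multiset_eqI)
  let ?M = "pole_of_wiring m k C"
  fix x :: "nat + nat"
  have sel: "edges ?M = {..<k}" "semiedges ?M = {1..m}"
    by (simp_all add: pole_of_wiring_def semiedges_def)
  show "count (incident ?M v) x = count (C ! v) x"
  proof (cases x)
    case (Inl e)
    have "count (image_mset Inr A) (Inl e) = 0" for A :: "nat multiset"
      by (auto simp: not_in_iff [symmetric])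
    then have "count (incident ?M v) x = (if e < k then count (C ! v) (Inl e) else 0)"
      using v by (simp add: Inl incident_def sel count_sum count_ends_pole_of_wiring)
    moreover have "count (C ! v) (Inl e) = 0" if "\<not> e < k"
      using count_wiring(1) [OF C, of e] that v by simp
    ultimately show ?thesis
      by (simp add: Inl)
  next
    case (Inr i)
    have "count (incident ?M v) x = (if i \<in> {1..m} \<and> attach ?M i = At v then 1 else 0)"
      by (simp add: Inr incident_def sel count_sum count_image_mset_inj count_mset_set')
    also have "\<dots> = count (C ! v) (Inr i)"
    proof (cases "i \<in> {1..m}")
      case True
      then obtain u where "count (C ! u) (Inr i) = 1"
        "\<And>v. v < length C \<Longrightarrow> v \<noteq> u \<Longrightarrow> count (C ! v) (Inr i) = 0" "attach ?M i = At u"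
        using wiring_semiedge [OF C] by metis
      with True v show ?thesis
        by (cases "v = u") auto
    next
      case False
      then show ?thesis
        using count_wiring(2) [OF C, of i] v by auto
    qed
    finally show ?thesis
      by (simp add: Inr)
  qed
qed

lemma m_pole_pole_of_wiring:
  assumes C: "wiring m k C" and "m \<ge> 1"
  shows "m_pole m (pole_of_wiring m k C)"
proof -
  let ?M = "pole_of_wiring m k C"
  have sel: "verts ?M = {..<length C}" "edges ?M = {..<k}" "nsemi ?M = m" "semiedges ?M = {1..m}"
    by (simp_all add: pole_of_wiring_def semiedges_def)
  have "size (ends ?M e) = 2" if "e < k" for e
    using count_wiring(1) [OF C, of e] that by (simp add: pole_of_wiring_def)
  moreover have "set_mset (ends ?M e) \<subseteq> verts ?M" for e
    by (auto simp: sel count_ends_pole_of_wiring simp flip: count_greater_zero_iff split: if_splits)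
  moreover have "\<exists>u<length C. attach ?M i = At u" if "i \<in> {1..m}" for i
    using wiring_semiedge [OF C that] by metis
  moreover have "size (incident ?M v) = 3" if "v < length C" for v
    using C that by (simp add: incident_pole_of_wiring wiring_def)
  ultimately show ?thesis
    using \<open>m \<ge> 1\<close> unfolding m_pole_def sel by fastforce
qed

text \<open>Since the neighbourhoods coincide, a colouring of the wiring is itself a Tait coloring;
  the free-edge condition is vacuous because \<open>attach\<close> only takes values
  \<open>At v\<close>.\<close>

lemma color_complete_pole_of_wiring:
  assumes C: "wiring m k C" and "wiring_complete m C"
  shows "color_complete (pole_of_wiring m k C)"
  unfolding color_complete_def
proof (intro allI impI)
  let ?M = "pole_of_wiring m k C"
  have sel: "verts ?M = {..<length C}" "nsemi ?M = m"
    by (simp_all add: pole_of_wiring_def)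
  fix xs
  assume "admissible (nsemi ?M) xs"
  then obtain \<phi> where \<phi>: "wiring_coloring C \<phi>" "map (\<lambda>i. \<phi> (Inr i)) [1..<Suc m] = xs"
    using assms(2) unfolding wiring_complete_def sel by blast
  have "tait_coloring ?M \<phi>"
    unfolding tait_coloring_def
  proof (intro conjI)
    show "\<phi> ` (edges ?M <+> semiedges ?M) \<subseteq> {1, 2, 3}"
      using \<phi>(1) unfolding wiring_coloring_def by blast
    show "\<forall>v\<in>verts ?M. \<forall>c. count (image_mset \<phi> (incident ?M v)) c \<le> 1"
      using \<phi>(1) C by (simp add: wiring_coloring_def sel incident_pole_of_wiring)
    show "\<forall>i\<in>semiedges ?M. \<forall>j. attach ?M i = Paired j \<longrightarrow> \<phi> (Inr i) = \<phi> (Inr j)"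
      by (simp add: pole_of_wiring_def)
  qed
  with \<phi>(2) show "is_state ?M xs"
    unfolding is_state_def sel by blast
qed

section \<open>The 5-pole and its colourings\<close>

lemma count_triple_le_1_iff:
  "(\<forall>c. count {#x, y, z#} c \<le> 1) \<longleftrightarrow> x \<noteq> y \<and> x \<noteq> z \<and> y \<noteq> z"
  by auto

text \<open>
  The 5-pole with outputs \<open>p, q, r\<close>, joined to the old pole along \<open>y, z\<close>. The entries can be
  either labels or, after applying a colouring, colours.
\<close>

definition gadget :: "'a \<Rightarrow> 'a \<Rightarrow> 'a \<Rightarrow> 'a \<Rightarrow> 'a \<Rightarrow> (nat \<Rightarrow> 'a) \<Rightarrow> 'a multiset list" where
  "gadget y z p q r e =
     [{#e 6, e 7, z#}, {#e 4, e 7, r#}, {#e 0, e 2, e 4#}, {#e 1, e 2, e 3#}, {#e 3, y, q#},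
      {#e 1, e 5, e 6#}, {#e 0, e 5, p#}]"

lemma gadget_image:
  "map (image_mset h) (gadget y z p q r e) = gadget (h y) (h z) (h p) (h q) (h r) (h \<circ> e)"
  by (simp add: gadget_def)

text \<open>The index is capped because \<open>es ! i\<close> is unspecified beyond the end of \<open>es\<close>.\<close>

lemma gadget_coloringI:
  assumes "\<forall>t\<in>set (gadget y z p q r (\<lambda>i. es ! (if i < 8 then i else 0))). \<forall>c. count t c \<le> 1"
    and "length es = 8" "set es \<subseteq> K" "{y, z} \<subseteq> K"
    and "\<forall>c\<in>K. even (count_list [y, z, p, q, r] c + 1)"
  shows "\<exists>y z e. {y, z} \<subseteq> K \<and> range e \<subseteq> K \<and>
    (\<forall>t\<in>set (gadget y z p q r e). \<forall>c. count t c \<le> 1) \<and>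
    (\<forall>c\<in>K. even (count_list [y, z, p, q, r] c + 1))"
proof -
  have "range (\<lambda>i. es ! (if i < 8 then i else 0)) \<subseteq> set es"
    using assms(2) by auto
  then have "range (\<lambda>i. es ! (if i < 8 then i else 0)) \<subseteq> K"
    using assms(3) by (rule order_trans)
  then show ?thesis
    using assms(1,4,5) by (intro exI conjI)
qed

text \<open>Up to renaming colours, the 27 triples fall into five equality patterns, each with an
  explicit colouring. The parity condition, that each colour occurs an odd number of times among the
  five, means \<open>y + z = p + q + r\<close> in the Klein four-group. So \<open>y = z\<close> if
  the outputs are distinct; otherwise \<open>y\<close> and \<open>z\<close> are the two colours
  other than the sum.\<close>

lemma gadget_coloring:
  fixes p q r :: nat
  assumes "{p, q, r} \<subseteq> {1, 2, 3}"
  shows "\<exists>y z e. {y, z} \<subseteq> {1, 2, 3} \<and> range e \<subseteq> {1, 2, 3} \<and>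
    (\<forall>t\<in>set (gadget y z p q r e). \<forall>c. count t c \<le> 1) \<and>
    (\<forall>c\<in>{1, 2, 3}. even (count_list [y, z, p, q, r] c + 1))"
proof -
  \<comment> \<open>The third colour is \<open>6 - a - b\<close>, as the three colours add up to
    6.\<close>
  have third: "\<exists>c. {1, 2, 3} = {a, b, c} \<and> a \<noteq> c \<and> b \<noteq> c"
    if "a \<noteq> b" "{a, b} \<subseteq> {1, 2, 3}" for a b :: nat
    using that by (intro exI [of _ "6 - a - b"]) auto
  note simps = gadget_def count_triple_le_1_iff
  consider (aaa) "p = q" "q = r" | (aab) "p = q" "q \<noteq> r" | (aba) "p = r" "p \<noteq> q"
    | (abb) "q = r" "p \<noteq> q" | (abc) "p \<noteq> q" "q \<noteq> r" "p \<noteq> r"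
    by blast
  then show ?thesis
  proof cases
    case aaa
    have "(if p = 1 then 2 else 1) \<noteq> p" "(if p = 1 then 2 else 1) \<in> {1, 2, 3 :: nat}"
      by auto
    then obtain b where b: "p \<noteq> b" "b \<in> {1, 2, 3}"
      by metis
    with assms obtain c where K: "{1, 2, 3} = {p, b, c}" and "p \<noteq> c" "b \<noteq> c"
      using third [of p b] by auto
    \<comment> \<open>In each case \<open>K\<close> rewrites the palette in terms of named distinct
      colours, and the list gives the colours of \<open>e 0\<close> to \<open>e 7\<close>; the
      vertex and parity conditions then follow by simplification.\<close>
    with aaa b(1) show ?thesis
      unfolding K
      by (intro gadget_coloringI [of b c _ _ _ "[b, b, p, c, c, c, p, b]"]) (simp_all add: simps)
  next
    case aab
    with assms obtain c where K: "{1, 2, 3} = {p, r, c}" and "p \<noteq> c" "r \<noteq> c"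
      using third [of p r] by auto
    with aab show ?thesis
      unfolding K
      by (intro gadget_coloringI [of c p _ _ _ "[r, p, c, r, p, c, r, c]"]) (simp_all add: simps)
  next
    case aba
    with assms obtain c where K: "{1, 2, 3} = {p, q, c}" and "p \<noteq> c" "q \<noteq> c"
      using third [of p q] by auto
    with aba show ?thesis
      unfolding K
      by (intro gadget_coloringI [of p c _ _ _ "[q, q, p, c, c, c, p, q]"]) (simp_all add: simps)
  next
    case abb
    with assms obtain c where K: "{1, 2, 3} = {p, q, c}" and "p \<noteq> c" "q \<noteq> c"
      using third [of p q] by auto
    with abb show ?thesis
      unfolding K
      by (intro gadget_coloringI [of c q _ _ _ "[q, q, c, p, p, c, p, c]"]) (simp_all add: simps)
  next
    case abc
    with assms have K: "{1, 2, 3} = {p, q, r}"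
      by auto
    from abc show ?thesis
      unfolding K
      by (intro gadget_coloringI [of r r _ _ _ "[q, q, r, p, p, r, p, q]"]) (simp_all add: simps)
  qed
qed

section \<open>Joining the 5-pole to a colour complete pole\<close>

text \<open>Turning the last two of \<open>l + 2\<close> semiedges into edges frees their labels,
  which \<open>join_gadget\<close> reuses for the outputs \<open>p\<close> and
  \<open>q\<close>.\<close>

definition semi_to_edge :: "nat \<Rightarrow> nat \<Rightarrow> nat + nat \<Rightarrow> nat + nat" where
  "semi_to_edge l k = id(Inr (l + 1) := Inl k, Inr (l + 2) := Inl (k + 1))"

definition join_gadget :: "nat \<Rightarrow> nat \<Rightarrow> (nat + nat) multiset list \<Rightarrow> (nat + nat) multiset list" where
  "join_gadget l k C = map (image_mset (semi_to_edge l k)) C @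
     gadget (Inl k) (Inl (k + 1)) (Inr (l + 1)) (Inr (l + 2)) (Inr (l + 3)) (\<lambda>i. Inl (k + 2 + i))"

text \<open>The ten new edges are the two joining edges \<open>k\<close>, \<open>k + 1\<close>, each
  with one end in the old pole and one in the gadget, and the eight inner edges from
  \<open>k + 2\<close> on, with both ends in the gadget.\<close>

lemma wiring_join_gadget:
  assumes "wiring (l + 2) k C"
  shows "wiring (l + 3) (k + 10) (join_gadget l k C)"
proof -
  have sum: "sum_list (map (image_mset f) C) = image_mset f (sum_list C)"
    for f :: "nat + nat \<Rightarrow> nat + nat" and C
    by (induction C) auto
  have edges: "image_mset (semi_to_edge l k) (image_mset Inl (mset_set {..<k}))
      = image_mset Inl (mset_set {..<k})"
    unfolding multiset.map_comp by (rule image_mset_cong) (simp add: semi_to_edge_def)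
  have old: "image_mset (semi_to_edge l k) (image_mset Inr (mset_set {1..l}))
      = image_mset Inr (mset_set {1..l})"
    unfolding multiset.map_comp by (rule image_mset_cong) (simp add: semi_to_edge_def)
  have suc: "mset_set {Suc 0..Suc n} = add_mset (Suc n) (mset_set {Suc 0..n})" for n
    by (simp add: atLeastAtMostSuc_conv)
  have "mset_set {1..l + 2} = mset_set {1..l} + {#l + 1, l + 2#}"
    by (simp add: eval_nat_numeral suc)
  then have semi: "image_mset (semi_to_edge l k) (image_mset Inr (mset_set {1..l + 2}))
      = image_mset Inr (mset_set {1..l}) + {#Inl k, Inl (k + 1)#}"
    by (simp only: image_mset_union old) (simp add: semi_to_edge_def)
  have "mset_set {..<k + 10} = mset_set {..<k} +
      {#k, k + 1, k + 2, k + 3, k + 4, k + 5, k + 6, k + 7, k + 8, k + 9#}"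
    by (simp add: eval_nat_numeral lessThan_Suc)
  moreover have "mset_set {1..l + 3} = mset_set {1..l} + {#l + 1, l + 2, l + 3#}"
    by (simp add: eval_nat_numeral suc)
  moreover have "sum_list (join_gadget l k C) =
      image_mset Inl (mset_set {..<k}) + image_mset Inl (mset_set {..<k}) +
      (image_mset Inr (mset_set {1..l}) + {#Inl k, Inl (k + 1)#}) +
      sum_list (gadget (Inl k) (Inl (k + 1)) (Inr (l + 1)) (Inr (l + 2)) (Inr (l + 3))
        (\<lambda>i. Inl (k + 2 + i)))"
  proof -
    have "sum_list C = image_mset Inl (mset_set {..<k}) + image_mset Inl (mset_set {..<k}) +
        image_mset Inr (mset_set {1..l + 2})"
      using assms by (simp only: wiring_def)
    then show ?thesis
      by (simp only: join_gadget_def sum_list_append sum image_mset_union edges semi)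
  qed
  ultimately have "sum_list (join_gadget l k C) =
      image_mset Inl (mset_set {..<k + 10}) + image_mset Inl (mset_set {..<k + 10}) +
      image_mset Inr (mset_set {1..l + 3})"
    by (simp add: gadget_def eval_nat_numeral)
  moreover have "\<forall>t\<in>set (join_gadget l k C). size t = 3"
    using assms by (auto simp: wiring_def join_gadget_def gadget_def)
  ultimately show ?thesis
    by (simp only: wiring_def)
qed

lemma wiring_complete_join_gadget:
  assumes C: "wiring (l + 2) k C" "wiring_complete (l + 2) C"
  shows "wiring_complete (l + 3) (join_gadget l k C)"
  unfolding wiring_complete_def
proof (intro allI impI)
  fix xs
  assume xs: "admissible (l + 3) xs"
  then have "length (drop l xs) = 3"
    by (simp add: admissible_def)
  then obtain p q r where "drop l xs = [p, q, r]"
    by (auto simp: numeral_3_eq_3 length_Suc_conv simp del: length_drop)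
  then have split: "xs = take l xs @ [p, q, r]"
    by (metis append_take_drop_id)
  define ys where "ys = take l xs"
  have ys: "length ys = l" "xs = ys @ [p, q, r]"
    using xs split by (simp_all add: admissible_def ys_def)
  then have pqr: "{p, q, r} \<subseteq> {1, 2, 3}"
    using xs by (simp add: admissible_def)
  then obtain y z e where yz: "{y, z} \<subseteq> {1, 2, 3}" and e: "range e \<subseteq> {1, 2, 3}"
    and gad: "\<forall>t\<in>set (gadget y z p q r e). \<forall>c. count t c \<le> 1"
    and par: "\<forall>c\<in>{1, 2, 3}. even (count_list [y, z, p, q, r] c + 1)"
    using gadget_coloring [OF pqr] by (elim exE conjE) (rule that)
  have "admissible (l + 2) (ys @ [y, z])"
  proof -
    have "count_list (ys @ [y, z]) c mod 2 = (l + 2) mod 2" if c: "c \<in> {1, 2, 3}" for c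
    proof -
      have "count_list xs c mod 2 = (l + 3) mod 2"
        using xs c unfolding admissible_def by blast
      then have "(count_list ys c + count_list [p, q, r] c) mod 2 = (l + 3) mod 2"
        by (simp add: ys)
      moreover have "even (count_list [y, z] c + count_list [p, q, r] c + 1)"
        using bspec [OF par c] count_list_append [of "[y, z]" "[p, q, r]" c]
        by (simp only: append.simps)
      ultimately have "(count_list ys c + count_list [y, z] c) mod 2 = (l + 2) mod 2"
        \<comment> \<open>Adding the two congruences modulo 2 cancels the count in
          \<open>[p, q, r]\<close>.\<close>
        by presburger
      then show ?thesis
        by simp
    qed
    then show ?thesis
      using xs yz ys by (simp add: admissible_def)
  qed
  then obtain \<phi> where \<phi>: "wiring_coloring C \<phi>"
    and "map (\<lambda>i. \<phi> (Inr i)) [1..<Suc (l + 2)] = ys @ [y, z]"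
    using C(2) unfolding wiring_complete_def by blast
  then have \<phi>_ys: "map (\<lambda>i. \<phi> (Inr i)) [1..<Suc l] = ys"
    and \<phi>_yz: "\<phi> (Inr (l + 1)) = y" "\<phi> (Inr (l + 2)) = z"
    by (simp_all add: numeral_2_eq_2)
  \<comment> \<open>The two colourings are glued along \<open>y\<close> and \<open>z\<close>. The
    last branches also colour labels beyond the range, so that all values of \<open>\<psi>\<close>
    are colours.\<close>
  define \<psi> where "\<psi> s = (case s of
      Inl j \<Rightarrow> if j < k then \<phi> s else if j = k then y else if j = k + 1 then z else e (j - k - 2)
    | Inr i \<Rightarrow> if i \<le> l then \<phi> s else if i = l + 1 then p else if i = l + 2 then q else r)" for s
  have \<phi>_range: "\<phi> s \<in> {1, 2, 3}" for s
    using \<phi> unfolding wiring_coloring_def by blast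
  have \<psi>_range: "range \<psi> \<subseteq> {1, 2, 3}"
  proof
    fix c
    assume "c \<in> range \<psi>"
    then obtain s where "c = \<psi> s"
      by blast
    moreover have "e j \<in> {1, 2, 3}" for j
      using e by blast
    ultimately show "c \<in> {1, 2, 3}"
      using \<phi>_range [of s] pqr yz unfolding \<psi>_def
      by (cases s) (simp_all del: insert_iff split: if_splits)
  qed
  have old: "image_mset \<psi> (image_mset (semi_to_edge l k) t) = image_mset \<phi> t" if "t \<in> set C" for t
    unfolding multiset.map_comp
  proof (rule image_mset_cong)
    fix s
    assume "s \<in># t"
    with that have "s \<in># sum_list C"
      by (induction C) auto
    \<comment> \<open>Agreement may fail at labels such as \<open>Inl k\<close>, where
      \<open>\<phi>\<close> is arbitrary; the label count of \<open>C\<close> excludes them.\<close>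
    with C(1) have s: "s \<in> Inl ` {..<k} \<union> Inr ` {1..l + 2}"
      by (auto simp: wiring_def)
    show "(\<psi> \<circ> semi_to_edge l k) s = \<phi> s"
    proof (cases s)
      case (Inl j)
      with s show ?thesis
        by (auto simp: \<psi>_def semi_to_edge_def)
    next
      case (Inr i)
      with s consider "i \<le> l" | "i = l + 1" | "i = l + 2"
        by fastforce
      then show ?thesis
        using \<phi>_yz by cases (simp_all add: Inr \<psi>_def semi_to_edge_def)
    qed
  qed
  have new: "map (image_mset \<psi>) (gadget (Inl k) (Inl (k + 1)) (Inr (l + 1)) (Inr (l + 2))
      (Inr (l + 3)) (\<lambda>i. Inl (k + 2 + i))) = gadget y z p q r e"
    unfolding gadget_image by (simp add: \<psi>_def comp_def)
  have "map (image_mset \<psi>) (join_gadget l k C) = map (image_mset \<phi>) C @ gadget y z p q r e"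
    using old new by (simp add: join_gadget_def)
  then have "image_mset \<psi> ` set (join_gadget l k C) =
      image_mset \<phi> ` set C \<union> set (gadget y z p q r e)"
    by (metis set_append set_map)
  then have "\<forall>t\<in>image_mset \<psi> ` set (join_gadget l k C). \<forall>c. count t c \<le> 1"
    using \<phi> gad unfolding wiring_coloring_def by auto
  with \<psi>_range have "wiring_coloring (join_gadget l k C) \<psi>"
    unfolding wiring_coloring_def by blast
  moreover have "map (\<lambda>i. \<psi> (Inr i)) [1..<Suc (l + 3)] = xs"
  proof -
    have "map (\<lambda>i. \<psi> (Inr i)) [1..<Suc l] = map (\<lambda>i. \<phi> (Inr i)) [1..<Suc l]"
      by (simp add: \<psi>_def del: upt_Suc)
    moreover have "[1..<Suc (l + 3)] = [1..<Suc l] @ [l + 1, l + 2, l + 3]"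
      by (simp add: numeral_2_eq_2 numeral_3_eq_3)
    moreover have "map (\<lambda>i. \<psi> (Inr i)) [l + 1, l + 2, l + 3] = [p, q, r]"
      by (simp add: \<psi>_def)
    ultimately show ?thesis
      by (simp only: map_append \<phi>_ys ys)
  qed
  ultimately show "\<exists>\<phi>. wiring_coloring (join_gadget l k C) \<phi> \<and> map (\<lambda>i. \<phi> (Inr i)) [1..<Suc (l + 3)] = xs"
    by blast
qed

section \<open>The smallest poles and the induction\<close>

text \<open>For \<open>m = 3\<close> each colour occurs an odd number of times, hence exactly once,
  so the admissible triples are the permutations of the colours.\<close>

lemma wiring_vertex:
  "wiring 3 0 [{#Inr 1, Inr 2, Inr 3#}]"
  "wiring_complete 3 [{#Inr 1, Inr 2, Inr 3#}]"
proof -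
  have "{1..3} = {1, 2, 3 :: nat}"
    by auto
  then show "wiring 3 0 [{#Inr 1, Inr 2, Inr 3#}]"
    by (simp add: wiring_def)
  show "wiring_complete 3 [{#Inr 1, Inr 2, Inr 3#}]"
    unfolding wiring_complete_def
  proof (intro allI impI)
    fix xs
    assume xs: "admissible 3 xs"
    then obtain p q r where pqr: "xs = [p, q, r]"
      by (auto simp: admissible_def numeral_3_eq_3 length_Suc_conv)
    with xs have "p \<noteq> q \<and> p \<noteq> r \<and> q \<noteq> r" "{p, q, r} \<subseteq> {1, 2, 3}"
      by (auto simp: admissible_def split: if_splits)
    moreover define \<phi> where "\<phi> s = (if s = Inr 1 then p else if s = Inr 2 then q else r)"
      for s :: "nat + nat"
    ultimately have "wiring_coloring [{#Inr 1, Inr 2, Inr 3#}] \<phi>"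
      by (auto simp: wiring_coloring_def)
    moreover have "map (\<lambda>i. \<phi> (Inr i)) [1..<Suc 3] = xs"
      by (simp add: \<phi>_def pqr upt_rec)
    ultimately show "\<exists>\<phi>. wiring_coloring [{#Inr 1, Inr 2, Inr 3#}] \<phi> \<and>
        map (\<lambda>i. \<phi> (Inr i)) [1..<Suc 3] = xs"
      by blast
  qed
qed

lemma wiring_complete_exists: "\<exists>k C. wiring (n + 3) k C \<and> wiring_complete (n + 3) C"
proof (induction n)
  case 0
  show ?case
    using wiring_vertex by auto
next
  case (Suc n)
  \<comment> \<open>The length \<open>n + 3\<close> is read as \<open>l + 2\<close> with
    \<open>l = Suc n\<close>, the form required for joining.\<close>
  then obtain k C where "wiring (Suc n + 2) k C" "wiring_complete (Suc n + 2) C"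
    by (auto simp: numeral_2_eq_2 numeral_3_eq_3)
  then show ?case
    using wiring_join_gadget wiring_complete_join_gadget by blast
qed

text \<open>The index \<open>3 - i\<close> exchanges the semiedges 1 and 2.\<close>

definition free_edge :: "(nat, nat) multipole" where
  "free_edge = \<lparr>verts = {}, edges = {}, ends = (\<lambda>_. {#}), nsemi = 2, attach = (\<lambda>i. Paired (3 - i))\<rparr>"

lemma m_pole_free_edge: "m_pole 2 free_edge"
  by (auto simp: m_pole_def free_edge_def semiedges_def) presburger

text \<open>For \<open>m = 2\<close> all colour counts are even, so both entries agree and a
  constant colouring realizes them.\<close>

lemma color_complete_free_edge: "color_complete free_edge"
  unfolding color_complete_def
proof (intro allI impI)
  fix xs
  assume xs: "admissible (nsemi free_edge) xs"
  then obtain p q where pq: "xs = [p, q]"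
    by (auto simp: admissible_def free_edge_def numeral_2_eq_2 length_Suc_conv)
  with xs have "p = q" "p \<in> {1, 2, 3}"
    by (auto simp: admissible_def free_edge_def split: if_splits)
  then have "tait_coloring free_edge (\<lambda>_. p)" "xs = map (\<lambda>i. p) [1..<Suc (nsemi free_edge)]"
    by (auto simp: tait_coloring_def free_edge_def pq upt_rec)
  then show "is_state free_edge xs"
    unfolding is_state_def by blast
qed

theorem mainTheorem3:
  fixes m :: nat
  assumes "m \<ge> 2"
  shows "\<exists>M :: (nat, nat) multipole. m_pole m M \<and> color_complete M"
proof (cases "m = 2")
  case True
  then show ?thesis
    using m_pole_free_edge color_complete_free_edge by blast
next
  case False
  with assms have "m = (m - 3) + 3"
    by simp
  then obtain k C where "wiring m k C" "wiring_complete m C"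
    using wiring_complete_exists by metis
  then show ?thesis
    using m_pole_pole_of_wiring color_complete_pole_of_wiring assms
    by (metis One_nat_def Suc_1 Suc_leD)
qed

end
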